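(* Fix an integer $k\ge0$ and let $(x_n)_{n\ge1}$ be the sequence of positive integers defined by $x_{n+1}=\varphi(x_n)+k$ for all $n\in\mathbb{N}$, with starting value $x_1\in\mathbb{N}$, where $\varphi$ is Euler's totient function. Then $$\sup_{n\in\mathbb{N}}x_n\le\max\{x_1,k^4\}+(k+1)^2.$$ In particular, $(x_n)_{n\ge1}$ is eventually periodic (i.e., there exists $T\in\mathbb{N}$ with $x_{n+T}=x_n$ for all sufficiently large $n$).
   Context: $\mathbb{N}$ denotes the set of positive integers; $\varphi(n)$ is the number of integers in $\{1,\ldots,n\}$ coprime to $n$. *)

theory Defs
  imports "HOL-Number_Theory.Totient" "HOL-Library.Extended_Nat"
begin

end

theory Submission
  imports Defs
begin

text \<open>
  A composite \<open>n\<close> satisfies \<open>\<phi>(n) \<le> n - \<surd>n\<close>, so beyond \<open>k\<^sup>4\<close> a composite term is followed by a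
  drop of at least \<open>k\<^sup>2 - k\<close>. A prime term is followed by an increase of exactly \<open>k - 1\<close>, and a
  run of consecutive primes is an arithmetic progression of difference \<open>k - 1\<close>; since
  \<open>k - 1 \<equiv> -1 (mod k)\<close>, among any \<open>k\<close> consecutive terms one is divisible by \<open>k\<close>, so the
  run has fewer than \<open>k\<close> members. Its total gain, at most \<open>(k - 1)\<^sup>2\<close>, is undone by the drop at
  the composite term that ends it.
\<close>

text \<open>Write \<open>n = a * b\<close> with \<open>1 < a\<close> and \<open>a \<le> b\<close>:
  the \<open>b\<close> multiples of \<open>a\<close> up to \<open>n\<close> share the factor
  \<open>a\<close> with \<open>n\<close>, and \<open>b < s\<close> would force
  \<open>n \<le> s * s\<close>. The integer \<open>s\<close> stands in for the square root of
  \<open>n\<close>.\<close>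

lemma totient_composite_le:
  fixes n s :: nat
  assumes "n > 1" and "\<not> prime n" and "s * s < n"
  shows "totient n + s \<le> n"
proof -
  obtain a b where ab: "n = a * b" "1 < a" "a \<le> b"
  proof -
    obtain c where "c dvd n" "c \<noteq> 1" "c \<noteq> n"
      using assms by (auto simp: prime_nat_iff)
    then obtain e where e: "n = c * e" by (auto elim: dvdE)
    with \<open>c \<noteq> 1\<close> \<open>c \<noteq> n\<close> \<open>n > 1\<close> have "1 < c" "1 < e"
      by (auto intro!: Nat.gr0I simp: nat_neq_iff)
    with e that[of c e] that[of e c] show thesis
      by (cases "c \<le> e") (auto simp: mult.commute)
  qed
  have sb: "s \<le> b"
  proof (rule ccontr)
    assume "\<not> s \<le> b"
    then have "a * b \<le> s * s" using ab by (intro mult_mono) auto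
    with assms ab show False by simp
  qed
  have sub: "totatives n \<subseteq> {1..n} - (*) a ` {1..b}"
    using ab by (auto simp: totatives_def)
  have img: "(*) a ` {1..b} \<subseteq> {1..n}" using ab by auto
  have "totient n \<le> card ({1..n} - (*) a ` {1..b})"
    unfolding totient_def by (intro card_mono sub) auto
  also have "\<dots> = n - b"
    using ab img by (subst card_Diff_subset) (auto simp: card_image inj_on_def)
  finally have "totient n \<le> n - b" .
  moreover have "b \<le> n" using ab by simp
  ultimately show ?thesis using sb by linarith
qed

lemma prime_progression_length:
  fixes d j y :: nat
  assumes "d \<ge> 1" and "y > Suc d" and run: "\<And>i. i < j \<Longrightarrow> prime (y + i * d)"
  shows "j \<le> d"
proof (rule ccontr)
  assume "\<not> j \<le> d"
  \<comment> \<open>Modulo \<open>Suc d\<close> the difference \<open>d\<close> is -1, so this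
    \<open>i\<close> cancels the residue of \<open>y\<close>.\<close>
  define i where "i = y mod Suc d"
  have "i < Suc d" by (simp add: i_def)
  with \<open>\<not> j \<le> d\<close> have pr: "prime (y + i * d)" by (intro run) linarith
  have "y + i * d = Suc d * (y div Suc d + i)"
    using div_mult_mod_eq[of y "Suc d"] unfolding i_def[symmetric]
    by (simp add: algebra_simps)
  then have "Suc d dvd y + i * d" by (rule dvdI)
  with pr have "Suc d = 1 \<or> Suc d = y + i * d" by (auto simp: prime_nat_iff)
  with assms show False by auto
qed

text \<open>By pigeonhole two terms coincide, and the recurrence carries the coincidence
  forward.\<close>

lemma eventually_periodic_of_bounded_recurrence:
  fixes f :: "nat \<Rightarrow> nat" and x :: "nat \<Rightarrow> nat"
  assumes rec: "\<And>n. n \<ge> N \<Longrightarrow> x (Suc n) = f (x n)"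
    and bdd: "\<And>n. n \<ge> N \<Longrightarrow> x n \<le> B"
  shows "\<exists>T\<ge>1. \<forall>\<^sub>F n in sequentially. x (n + T) = x n"
proof -
  have "finite (x ` {N..})" using bdd by (auto intro: finite_subset[of _ "{..B}"])
  then have "\<not> inj_on x {N..}" using finite_imageD infinite_Ici by blast
  then obtain m n where mn: "N \<le> m" "m < n" "x m = x n"
    unfolding inj_on_def by (metis atLeast_iff linorder_neqE_nat)
  have "x (m + i + (n - m)) = x (m + i)" for i
  proof (induction i)
    case 0
    show ?case using mn by simp
  next
    case (Suc i)
    with mn rec[of "m + i"] rec[of "m + i + (n - m)"] show ?case by simp
  qed
  then have "x (l + (n - m)) = x l" if "l \<ge> m" for l
    using that by (metis le_add_diff_inverse)
  with mn show ?thesis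
    by (intro exI[of _ "n - m"]) (auto simp: eventually_sequentially)
qed

text \<open>With \<open>k = Suc d\<close>, a prime step adds exactly \<open>d\<close>, which avoids
  truncated subtraction.\<close>

lemma totient_recurrence_bound:
  fixes d :: nat and x :: "nat \<Rightarrow> nat"
  assumes rec: "\<And>n. n \<ge> 1 \<Longrightarrow> x (Suc n) = totient (x n) + Suc d"
    and "n \<ge> 1"
  shows "x n \<le> max (x 1) (Suc d ^ 4) + Suc d + d * d"
proof -
  define M where "M = max (x 1) (Suc d ^ 4) + Suc d"
  \<comment> \<open>Invariant of the induction: \<open>v\<close> is at most \<open>M\<close> or ends
    a prime run begun in the window above \<open>k^4\<close> and up to \<open>M\<close>. Only the
    terms before \<open>v\<close> must be prime, so \<open>v\<close> may be the composite that stops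
    the run.\<close>
  define reach where "reach v \<longleftrightarrow> v \<le> M \<or>
    (\<exists>y j. Suc d ^ 4 < y \<and> y \<le> M \<and> v = y + j * d \<and> (\<forall>i<j. prime (y + i * d)))" for v
  have gain: "j * d \<le> d * d"
    if "Suc d ^ 4 < y" and "\<forall>i<j. prime (y + i * d)" for y j
  \<comment> \<open>For \<open>d = 0\<close> a run may be arbitrarily long, but it gains
    nothing.\<close>
  proof (cases "d = 0")
    case False
    have "Suc d \<le> Suc d ^ 4" by (rule self_le_power) simp_all
    also note \<open>Suc d ^ 4 < y\<close>
    finally have "Suc d < y" .
    then have "j \<le> d"
      using prime_progression_length[of d y j] False that(2) by simp
    then show ?thesis by simp
  qed simp
  have reach_step: "reach (totient v + Suc d)" if "reach v" for v
  proof (cases "v \<le> Suc d ^ 4")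
    case True
    \<comment> \<open>The summand \<open>Suc d\<close> in \<open>M\<close> pays for this
      step.\<close>
    with totient_le[of v] have "totient v + Suc d \<le> M" unfolding M_def by linarith
    then show ?thesis unfolding reach_def ..
  next
    case False
    obtain y j where y: "Suc d ^ 4 < y" "y \<le> M" "v = y + j * d"
        and pr: "\<forall>i<j. prime (y + i * d)"
    proof (cases "v \<le> M")
      case True
      \<comment> \<open>An empty run starting at \<open>v\<close> itself.\<close>
      with False show ?thesis by (intro that[of v 0]) simp_all
    next
      case False
      with \<open>reach v\<close> that show ?thesis unfolding reach_def by blast
    qed
    have "1 \<le> Suc d ^ 4" by simp
    with False have "v > 1" by linarith
    show ?thesis
    proof (cases "prime v")
      case True
      then have "totient v + Suc d = y + Suc j * d"
        using y \<open>v > 1\<close> by (simp add: totient_prime)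
      moreover have "\<forall>i<Suc j. prime (y + i * d)"
        using True pr y by (auto simp: less_Suc_eq)
      ultimately show ?thesis using y unfolding reach_def by blast
    next
      case nonprime: False
      have "(Suc d * Suc d) * (Suc d * Suc d) < v"
        using False by (simp only: power4_eq_xxxx mult.assoc not_le)
      then have "totient v + Suc d * Suc d \<le> v"
        using totient_composite_le \<open>v > 1\<close> nonprime by blast
      \<comment> \<open>The drop suffices because \<open>Suc d * Suc d\<close> is at least
        \<open>d * d + Suc d\<close>.\<close>
      then have "totient v + Suc d \<le> y"
        using gain[OF y(1) pr] y(3) unfolding mult_Suc mult_Suc_right by linarith
      also note \<open>y \<le> M\<close>
      finally show ?thesis unfolding reach_def ..
    qed
  qed
  from \<open>n \<ge> 1\<close> have "reach (x n)"
  proof (induction n rule: dec_induct)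
    case base
    have "x 1 \<le> M" unfolding M_def by linarith
    then show ?case unfolding reach_def ..
  next
    case (step n)
    then show ?case using reach_step[of "x n"] rec[of n] by (simp only:)
  qed
  then have "x n \<le> M + d * d"
    unfolding reach_def
  proof (elim disjE exE conjE)
    fix y j
    assume y: "Suc d ^ 4 < y" "y \<le> M" "x n = y + j * d" and "\<forall>i<j. prime (y + i * d)"
    then have "j * d \<le> d * d" by (intro gain)
    with y show ?thesis by linarith
  qed linarith
  then show ?thesis unfolding M_def .
qed

theorem theorem1p2:
  fixes k :: nat and x :: "nat \<Rightarrow> nat"
  assumes start: "x 1 \<ge> 1"
    and rec: "\<And>n. n \<ge> 1 \<Longrightarrow> x (n + 1) = totient (x n) + k"
  shows "(SUP n\<in>{1..}. enat (x n)) \<le> enat (max (x 1) (k ^ 4) + (k + 1)\<^sup>2)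
    \<and> (\<exists>T\<ge>1. \<forall>\<^sub>F n in sequentially. x (n + T) = x n)"
proof -
  have bound: "x n \<le> max (x 1) (k ^ 4) + (k + 1)\<^sup>2" if "n \<ge> 1" for n
  proof (cases k)
    \<comment> \<open>Here the sequence is non-increasing.\<close>
    case 0
    from that have "x n \<le> x 1"
    proof (induction n rule: dec_induct)
      case (step n)
      with rec[of n] 0 totient_le[of "x n"] show ?case by simp
    qed simp
    then show ?thesis by simp
  next
    case (Suc d)
    have "x n \<le> max (x 1) (Suc d ^ 4) + Suc d + d * d"
      using rec Suc that by (intro totient_recurrence_bound) auto
    also have "\<dots> \<le> max (x 1) (k ^ 4) + (k + 1)\<^sup>2"
      using Suc by (simp add: power2_eq_square)
    finally show ?thesis .
  qed
  then have "(SUP n\<in>{1..}. enat (x n)) \<le> enat (max (x 1) (k ^ 4) + (k + 1)\<^sup>2)"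
    by (intro SUP_least) auto
  moreover have "\<exists>T\<ge>1. \<forall>\<^sub>F n in sequentially. x (n + T) = x n"
    using rec bound
    by (intro eventually_periodic_of_bounded_recurrence[where f = "\<lambda>v. totient v + k" and N = 1]) auto
  ultimately show ?thesis ..
qed

end
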